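(* Let $q$ be a prime power, let $G$ be an abelian group with $|G|=(q+1)(q^2+1)$, and let $D$ be a normalized difference set in $G$ with parameters $\left((q+1)(q^2+1),\,q^2+q+1,\,q+1\right)$. Then: (1) there is a unique subgroup $K$ of order $q^2+1$ in $G$; (2) for exactly one coset $Kx$ of $K$ in $G$ we have $|D\cap Kx|=1$, and $|D\cap Kx|=q+1$ for each of the other $q$ cosets of $K$.
   Context: A $(v,k,\lambda)$-difference set in an abelian group $G$ of order $v$ is a $k$-subset $D$ such that every non-identity element of $G$ is of the form $d_1d_2^{-1}$ with $d_1,d_2\in D$ in exactly $\lambda$ ways. It is normalized if $\prod_{d\in D}d=1$. *)

theory Defs
  imports "HOL-Algebra.Algebra" "HOL-Computational_Algebra.Primes"
begin

definition prime_power :: "nat \<Rightarrow> bool" where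
  "prime_power q \<longleftrightarrow> (\<exists>p n. Factorial_Ring.prime (p::nat) \<and> n > 0 \<and> q = p ^ n)"

definition difference_set :: "('a, 'b) monoid_scheme \<Rightarrow> 'a set \<Rightarrow> nat \<Rightarrow> nat \<Rightarrow> nat \<Rightarrow> bool" where
  "difference_set G D v k lam \<longleftrightarrow>
     finite (carrier G) \<and> card (carrier G) = v \<and> D \<subseteq> carrier G \<and> card D = k \<and>
     (\<forall>g \<in> carrier G. g \<noteq> \<one>\<^bsub>G\<^esub> \<longrightarrow>
        card {(d1, d2). d1 \<in> D \<and> d2 \<in> D \<and> d1 \<otimes>\<^bsub>G\<^esub> inv\<^bsub>G\<^esub> d2 = g} = lam)"

definition normalized :: "('a, 'b) monoid_scheme \<Rightarrow> 'a set \<Rightarrow> bool" where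
  "normalized G D \<longleftrightarrow> finprod G (\<lambda>d. d) D = \<one>\<^bsub>G\<^esub>"

end

theory Submission
  imports Defs "HOL-Number_Theory.Number_Theory" "HOL-Library.Function_Algebras"
begin

text \<open>
  Write \<open>q = p\<^sup>m\<close>. In the integral group ring, modulo \<open>p\<close> the \<open>p\<close>-th power of an element coincides
  with its image under the power map \<open>g \<mapsto> g\<^sup>p\<close>. As \<open>p\<close> does not divide \<open>|G|\<close>, this map has finite order,
  and therefore every ideal that contains a power of \<open>p\<close> is stable under it. Applied to the elements
  whose product with \<open>D\<^sup>-\<^sup>1\<close> is constant modulo \<open>q\<^sup>2 = k - \<lambda>\<close>, this shows that the \<open>p\<close>-th powers of \<open>D\<close> form a
  translate of \<open>D\<close>; normalization makes it \<open>D\<close> itself. So \<open>D\<close> is closed under \<open>d \<mapsto> d\<^sup>q\<close>.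

  Let \<open>L\<close> be a subgroup such that \<open>G/L\<close> has exponent dividing \<open>q + 1\<close>, so that \<open>d \<mapsto> d\<^sup>q\<close> inverts \<open>G/L\<close>. If
  \<open>c [G : L] = (q + 1)\<^sup>2\<close>, then \<open>E(x) = |D \<inter> Lx| - c\<close> is symmetric with \<open>E * E = q\<^sup>2 |L| 1\<^sub>L\<close>. As \<open>F\<^sub>p[G]\<close> is
  reduced, \<open>q\<close> divides \<open>E\<close>, and comparing sums of squares gives \<open>E = -q\<close> on one coset and \<open>E = 0\<close> elsewhere.
  For \<open>|L| = q\<^sup>2 + 1\<close> we have \<open>c = q + 1\<close>. If \<open>L\<close> is the intersection of two subgroups of order \<open>q\<^sup>2 + 1\<close>,
  of index \<open>r\<close> in each, then \<open>c = (q + 1) / r\<close>, and \<open>c \<ge> q\<close> forces \<open>r = 1\<close>.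
\<close>

section \<open>Frobenius lifts in commutative rings\<close>

context comm_ring_1 begin
lemma diff_dvd_power_diff: "a - b dvd a ^ n - b ^ n"
proof (induction n)
  case (Suc n)
  have "a ^ Suc n - b ^ Suc n = a * (a ^ n - b ^ n) + (a - b) * b ^ n" by (simp add: algebra_simps)
  then show ?case using Suc by (simp add: dvd_add dvd_mult dvd_mult2)
qed simp

text \<open>The inner binomial coefficients are divisible by p. A divisibility rather than an
  equation, since the integral group ring has characteristic zero.\<close>

lemma freshmans_dream_dvd:
  fixes p :: nat
  assumes "Factorial_Ring.prime p"
  shows "of_nat p dvd (a + b) ^ p - (a ^ p + b ^ p)"
proof -
  have p: "p > 0" using assms by (simp add: prime_gt_0_nat)
  have "(a + b) ^ p = (\<Sum>k\<le>p. of_nat (p choose k) * a ^ k * b ^ (p - k))" by (rule binomial_ring)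
  also have "{..p} = insert 0 (insert p {1..<p})" using p by auto
  also have "(\<Sum>k\<in>\<dots>. of_nat (p choose k) * a ^ k * b ^ (p - k)) =
     b ^ p + (a ^ p + (\<Sum>k\<in>{1..<p}. of_nat (p choose k) * a ^ k * b ^ (p - k)))"
    using p by simp
  finally have *: "(a + b) ^ p - (a ^ p + b ^ p) = (\<Sum>k\<in>{1..<p}. of_nat (p choose k) * a ^ k * b ^ (p - k))"
    by (simp add: algebra_simps)
  have "of_nat p dvd of_nat (p choose k)" if "k \<in> {1..<p}" for k
  proof -
    have "p dvd p choose k" using that assms by (intro dvd_choose_prime) auto
    then show ?thesis by (auto elim!: dvdE)
  qed
  then show ?thesis unfolding * by (intro dvd_sum dvd_mult2)
qed

text \<open>Lifting the exponent: a^p - b^p is a - b times a cofactor, and the cofactor is congruent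
  to p b^(p-1), hence to 0, modulo p because a and b agree there.\<close>

lemma prime_power_dvd_power_diff:
  fixes p :: nat
  assumes "of_nat (p ^ Suc j) dvd a - b"
  shows "of_nat (p ^ Suc (Suc j)) dvd a ^ p - b ^ p"
proof -
  define S where "S = (\<lambda>n. \<Sum>i<n. a ^ i * b ^ (n - Suc i))"
  have S_Suc: "S (Suc n) = a ^ n + b * S n" for n
  proof -
    have "(\<Sum>i<n. a ^ i * b ^ (n - i)) = (\<Sum>i<n. b * (a ^ i * b ^ (n - Suc i)))"
      by (intro sum.cong) (auto simp: mult_ac simp flip: Suc_diff_Suc)
    then show ?thesis by (simp add: S_def sum_distrib_left add_ac)
  qed
  have S: "a ^ n - b ^ n = (a - b) * S n" for n
  proof (induction n)
    case 0 show ?case by (simp add: S_def)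
  next
    case (Suc n)
    have "a ^ Suc n - b ^ Suc n = (a - b) * a ^ n + b * (a ^ n - b ^ n)" by (simp add: algebra_simps)
    then show ?case by (simp add: Suc S_Suc algebra_simps)
  qed
  have pab: "of_nat p dvd a - b"
    using assms by (auto elim!: dvdE simp: mult.assoc)
  have S_mod: "of_nat p dvd S n - of_nat n * b ^ (n - 1)" for n
  proof (induction n)
    case 0 show ?case by (simp add: S_def)
  next
    case (Suc n)
    have "of_nat p dvd a ^ n - b ^ n" using pab diff_dvd_power_diff dvd_trans by blast
    moreover have "S (Suc n) - of_nat (Suc n) * b ^ (Suc n - 1) =
        (a ^ n - b ^ n) + b * (S n - of_nat n * b ^ (n - 1))"
      by (cases n) (simp_all add: S_Suc algebra_simps)
    ultimately show ?case using Suc by (simp add: dvd_add dvd_mult)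
  qed
  have "S p = (S p - of_nat p * b ^ (p - 1)) + of_nat p * b ^ (p - 1)" by simp
  then have "of_nat p dvd S p" using S_mod[of p] by (metis dvd_add dvd_triv_left)
  then have "of_nat p * of_nat (p ^ Suc j) dvd S p * (a - b)" using assms by (rule mult_dvd_mono)
  then show ?thesis by (simp add: S mult_ac)
qed

lemma prime_power_dvd_power_prime_power_diff:
  fixes p j :: nat and a b :: 'a
  assumes "of_nat p dvd a - b"
  shows "of_nat (p ^ Suc j) dvd a ^ (p ^ j) - b ^ (p ^ j)"
proof (induction j)
  case 0 then show ?case using assms by simp
next
  case (Suc j)
  then show ?case using prime_power_dvd_power_diff[OF Suc]
    by (simp add: ab_semigroup_mult_class.mult.commute[of p] power_mult)
qed

text \<open>Used with n > 0 and \<open>\<psi> ^^ n\<close> the identity: then x is congruent to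
  x^(p^n) modulo p, so the ring modulo p has no nilpotents.\<close>

lemma frobenius_lift_funpow:
  fixes p n :: nat and x :: 'a and \<psi> :: "'a \<Rightarrow> 'a"
  assumes frob: "\<And>x. of_nat p dvd \<psi> x - x ^ p"
  shows "of_nat p dvd (\<psi> ^^ n) x - x ^ (p ^ n)"
proof (induction n)
  case (Suc n)
  have "of_nat p dvd ((\<psi> ^^ n) x) ^ p - (x ^ (p ^ n)) ^ p"
    using Suc diff_dvd_power_diff dvd_trans by blast
  then have "of_nat p dvd (\<psi> ((\<psi> ^^ n) x) - ((\<psi> ^^ n) x) ^ p) + (((\<psi> ^^ n) x) ^ p - (x ^ (p ^ n)) ^ p)"
    using frob dvd_add by blast
  moreover have "(\<psi> ((\<psi> ^^ n) x) - ((\<psi> ^^ n) x) ^ p) + (((\<psi> ^^ n) x) ^ p - (x ^ (p ^ n)) ^ p) =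
      \<psi> ((\<psi> ^^ n) x) - (x ^ (p ^ n)) ^ p"
    by (simp add: algebra_simps)
  ultimately show ?case by (simp add: ab_semigroup_mult_class.mult.commute[of p] power_mult)
qed simp

text \<open>The power \<open>x\<^sup>s\<close> with \<open>s = p\<^sup>N\<close> behaves like a Teichmueller representative: it lies in the ideal, it is
  congruent to \<open>x\<close> modulo \<open>p\<close>, and \<open>\<psi>\<close> acts on it as the \<open>p\<close>-th power modulo a high power of \<open>p\<close>.
  Induct on \<open>k\<close> by passing to the colon ideal of \<open>p\<close>.\<close>
lemma frobenius_lift_in_ideal:
  fixes p k :: nat and I :: "'a set" and x :: 'a and \<psi> :: "'a \<Rightarrow> 'a"
  assumes "p > 0"
    and add: "\<And>x y. \<psi> (x + y) = \<psi> x + \<psi> y" and mult: "\<And>x y. \<psi> (x * y) = \<psi> x * \<psi> y"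
    and one: "\<psi> 1 = 1"
    and frob: "\<And>x. of_nat p dvd \<psi> x - x ^ p"
    and period: "\<And>x. (\<psi> ^^ e) x = x" "e > 0"
    and I_add: "\<And>x y. x \<in> I \<Longrightarrow> y \<in> I \<Longrightarrow> x + y \<in> I" and I_mult: "\<And>r x. x \<in> I \<Longrightarrow> r * x \<in> I"
    and "of_nat (p ^ k) \<in> I" "x \<in> I"
  shows "\<psi> x \<in> I"
  using I_add I_mult \<open>of_nat (p ^ k) \<in> I\<close> \<open>x \<in> I\<close>
proof (induction k arbitrary: I x)
  case 0
  then have "1 \<in> I" by simp
  then show ?case using 0(2)[of 1 "\<psi> x"] by simp
next
  case (Suc k)
  \<comment> \<open>A multiple of e, so that \<open>\<psi> ^^ N\<close> is the identity and x is
    congruent to x^(p^N) modulo p; at least \<open>Suc k\<close>, so that p^(N+1) is a multiple of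
    the power of p in I.\<close>
  define N where "N = e * Suc k"
  have N: "Suc k \<le> N" using mult_le_mono1[of 1 e "Suc k"] \<open>e > 0\<close> by (simp add: N_def)
  have zero: "\<psi> 0 = 0" using add[of 0 0] by simp
  have of_nat: "\<psi> (of_nat n * y) = of_nat n * \<psi> y" for n y
    by (induction n) (simp_all add: zero add algebra_simps)
  have power: "\<psi> (y ^ n) = \<psi> y ^ n" for y n
    by (induction n) (simp_all add: one mult)
  have period_mult: "(\<psi> ^^ (e * n)) y = y" for n y
    by (induction n) (simp_all add: funpow_add period)
  define T where "T = x ^ (p ^ N)"
  have T_in: "T \<in> I"
  proof -
    have "p ^ N = Suc (p ^ N - 1)" using \<open>p > 0\<close> by simp
    then have "T = x ^ (p ^ N - 1) * x" unfolding T_def by (metis power_Suc2)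
    then show ?thesis using Suc.prems by simp
  qed
  have "of_nat p dvd x - T"
    using frobenius_lift_funpow[OF frob, where n=N and x=x] by (simp add: N_def T_def period_mult del: mult_Suc_right)
  then obtain y where y: "x = T + of_nat p * y"
    by (metis dvdE add_diff_cancel_left' diff_add_cancel add.commute)
  have y_in: "of_nat p * y \<in> I"
  proof -
    have "of_nat p * y = x + (- 1) * T" using y by simp
    then show ?thesis using Suc.prems T_in by metis
  qed
  \<comment> \<open>Raising the congruence of \<psi> x and x^p modulo p to the power p^N sharpens
    the modulus to p^(N+1).\<close>
  have "of_nat (p ^ Suc N) dvd (\<psi> x) ^ (p ^ N) - (x ^ p) ^ (p ^ N)"
    by (rule prime_power_dvd_power_prime_power_diff[OF frob])
  then have "of_nat (p ^ Suc N) dvd \<psi> T - T ^ p"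
    by (simp add: T_def power ab_semigroup_mult_class.mult.commute flip: power_mult)
  moreover have "(of_nat (p ^ Suc k) :: 'a) dvd of_nat (p ^ Suc N)"
  proof -
    have "p ^ Suc k dvd p ^ Suc N" using N by (intro comm_semiring_1_class.le_imp_power_dvd) simp
    then obtain c where "p ^ Suc N = p ^ Suc k * c" by (rule dvd_class.dvdE)
    then show ?thesis by (metis dvd_triv_left of_nat_mult)
  qed
  ultimately obtain z where z: "\<psi> T = T ^ p + of_nat (p ^ Suc k) * z"
    by (metis dvdE dvd_trans add_diff_cancel_left' diff_add_cancel add.commute)
  have "T ^ p \<in> I"
    using T_in Suc.prems(2)[of T "T ^ (p - 1)"] \<open>p > 0\<close> by (metis Suc_diff_1 power_Suc2)
  moreover have "of_nat (p ^ Suc k) * z \<in> I" using Suc.prems by (metis mult.commute)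
  ultimately have "\<psi> T \<in> I" using z Suc.prems by simp
  \<comment> \<open>The colon ideal contains p^k and y, so the induction hypothesis covers the
    second summand of \<psi> x = \<psi> T + p \<psi> y.\<close>
  moreover have "\<psi> y \<in> {z. of_nat p * z \<in> I}"
  proof (rule Suc.IH)
    show "of_nat (p ^ k) \<in> {z. of_nat p * z \<in> I}" using Suc.prems by simp
    show "y \<in> {z. of_nat p * z \<in> I}" using y_in by simp
    show "u + v \<in> {z. of_nat p * z \<in> I}" if "u \<in> {z. of_nat p * z \<in> I}" "v \<in> {z. of_nat p * z \<in> I}" for u v
      using that Suc.prems by (simp add: distrib_left)
    show "r * u \<in> {z. of_nat p * z \<in> I}" if "u \<in> {z. of_nat p * z \<in> I}" for r u
      using that Suc.prems by (simp add: mult.left_commute)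
  qed
  ultimately have "\<psi> T + of_nat p * \<psi> y \<in> I" using Suc.prems by simp
  then show ?case by (simp add: y add of_nat)
qed

text \<open>The ring modulo p is reduced: if p divides x^2, it divides x^(p^e), which is congruent
  to x modulo p. Write x = p y, cancel p^2 from the hypothesis and repeat with y.\<close>

lemma prime_power_dvd_of_dvd_square:
  fixes p m :: nat and x :: 'a and \<psi> :: "'a \<Rightarrow> 'a"
  assumes "p > 1"
    and frob: "\<And>x. of_nat p dvd \<psi> x - x ^ p"
    and period: "\<And>x. (\<psi> ^^ e) x = x" "e > 0"
    and cancel: "\<And>x y. of_nat p * x = of_nat p * y \<Longrightarrow> x = y"
    and "of_nat (p ^ (2 * m)) dvd x * x"
  shows "of_nat (p ^ m) dvd x"
  using assms(6)
proof (induction m arbitrary: x)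
  case 0 show ?case by simp
next
  case (Suc m)
  have "of_nat p dvd x * x" using Suc.prems by (auto elim!: dvdE simp: mult.assoc)
  moreover have "x * x dvd x ^ (p ^ e)"
  proof -
    have "2 \<le> p ^ e" using \<open>p > 1\<close> \<open>e > 0\<close> by (metis Suc_1 Suc_leI one_less_power)
    then have "x ^ (p ^ e) = x * x * x ^ (p ^ e - 2)" by (metis le_add_diff_inverse power2_eq_square power_add)
    then show ?thesis by simp
  qed
  ultimately have "of_nat p dvd x ^ (p ^ e)" using dvd_trans by blast
  moreover have "of_nat p dvd x - x ^ (p ^ e)"
    using frobenius_lift_funpow[OF frob, where n=e and x=x] by (simp add: period)
  ultimately have "of_nat p dvd (x - x ^ (p ^ e)) + x ^ (p ^ e)" using dvd_add by blast
  then obtain y where y: "x = of_nat p * y" by (auto elim!: dvdE)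
  obtain z where "x * x = of_nat (p ^ (2 * Suc m)) * z" using Suc.prems by (auto elim!: dvdE)
  then have "of_nat p * (of_nat p * (y * y)) = of_nat p * (of_nat p * (of_nat (p ^ (2 * m)) * z))"
    by (simp add: y mult_ac)
  then have "y * y = of_nat (p ^ (2 * m)) * z" using cancel by blast
  then have "of_nat (p ^ m) dvd y" using Suc.IH by simp
  then show ?case by (auto simp: y intro: mult_dvd_mono)
qed

end

text \<open>Fermat's little theorem on all integers: the freshman's dream makes the claims for c and
  c + 1 equivalent, so induction runs in both directions from 0.\<close>

lemma prime_dvd_diff_power_int:
  fixes c :: int
  assumes p: "Factorial_Ring.prime p"
  shows "int p dvd c - c ^ p"
proof -
  have *: "(c + 1) - (c + 1) ^ p = (c - c ^ p) - ((c + 1) ^ p - (c ^ p + 1 ^ p))" for c :: int by simp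
  have step: "int p dvd (c + 1) - (c + 1) ^ p \<longleftrightarrow> int p dvd c - c ^ p" for c
    unfolding * using freshmans_dream_dvd[OF p, of c 1] by (intro dvd_diff_left_iff) simp
  show ?thesis
  proof (induction c rule: int_induct[where k = 0])
    case base
    show ?case using prime_gt_0_nat[OF p] by (simp add: zero_power)
  next
    case (step1 i)
    then show ?case by (simp only: step)
  next
    case (step2 i)
    then show ?case using step[of "i - 1"] by simp
  qed
qed

section \<open>The integral group ring of a finite abelian group\<close>

locale finite_comm_group = comm_group G for G (structure) +
  assumes finite_carrier [simp]: "finite (carrier G)"
begin

text \<open>Convolution on the carrier, pointwise multiplication elsewhere: this makes the whole function
  type a commutative ring, so that the theorems of the class \<^class>\<open>comm_ring_1\<close> can be
  interpreted.\<close>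
definition conv :: "('a \<Rightarrow> int) \<Rightarrow> ('a \<Rightarrow> int) \<Rightarrow> 'a \<Rightarrow> int" where
  "conv f g h = (if h \<in> carrier G then \<Sum>x\<in>carrier G. f x * g (inv x \<otimes> h) else f h * g h)"

text \<open>The value 1 outside the carrier is forced by the pointwise multiplication there.\<close>

definition conv_one :: "'a \<Rightarrow> int" where
  "conv_one x = (if x \<in> carrier G \<and> x \<noteq> \<one> then 0 else 1)"

lemma sum_translate:
  fixes f :: "'a \<Rightarrow> int"
  assumes "a \<in> carrier G"
  shows "(\<Sum>x\<in>carrier G. f (a \<otimes> x)) = (\<Sum>x\<in>carrier G. f x)"
  by (rule sum.reindex_bij_witness[where i = "\<lambda>x. inv a \<otimes> x" and j = "\<lambda>x. a \<otimes> x"])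
    (use assms in \<open>auto simp flip: m_assoc\<close>)

lemma sum_inverse:
  fixes f :: "'a \<Rightarrow> int"
  shows "(\<Sum>x\<in>carrier G. f (inv x)) = (\<Sum>x\<in>carrier G. f x)"
  by (rule sum.reindex_bij_witness[where i = "\<lambda>x. inv x" and j = "\<lambda>x. inv x"]) auto

lemma conv_commute: "conv f g = conv g f"
proof
  fix h
  have "(\<Sum>x\<in>carrier G. f x * g (inv x \<otimes> h)) = (\<Sum>x\<in>carrier G. g x * f (inv x \<otimes> h))" if h: "h \<in> carrier G"
    by (rule sum.reindex_bij_witness[where i = "\<lambda>x. inv x \<otimes> h" and j = "\<lambda>x. inv x \<otimes> h"])
      (use h in \<open>auto simp: inv_mult m_ac\<close>)
  then show "conv f g h = conv g f h" by (simp add: conv_def mult.commute)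
qed

lemma conv_assoc: "conv (conv f g) k = conv f (conv g k)"
proof
  fix h
  show "conv (conv f g) k h = conv f (conv g k) h"
  proof (cases "h \<in> carrier G")
    case h: True
    have "conv (conv f g) k h = (\<Sum>z\<in>carrier G. \<Sum>x\<in>carrier G. f x * g (inv x \<otimes> z) * k (inv z \<otimes> h))"
      using h by (simp add: conv_def sum_distrib_right)
    also have "\<dots> = (\<Sum>x\<in>carrier G. \<Sum>z\<in>carrier G. f x * g (inv x \<otimes> z) * k (inv z \<otimes> h))"
      by (rule sum.swap)
    also have "\<dots> = (\<Sum>x\<in>carrier G. \<Sum>y\<in>carrier G. f x * (g y * k (inv y \<otimes> (inv x \<otimes> h))))"
    proof (rule sum.cong[OF refl])
      fix x assume x: "x \<in> carrier G"
      have "(\<Sum>z\<in>carrier G. f x * g (inv x \<otimes> z) * k (inv z \<otimes> h)) =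
          (\<Sum>y\<in>carrier G. f x * g (inv x \<otimes> (x \<otimes> y)) * k (inv (x \<otimes> y) \<otimes> h))"
        using sum_translate[OF x] by (rule sym)
      also have "\<dots> = (\<Sum>y\<in>carrier G. f x * (g y * k (inv y \<otimes> (inv x \<otimes> h))))"
      proof (rule sum.cong[OF refl])
        fix y assume y: "y \<in> carrier G"
        have "inv x \<otimes> (x \<otimes> y) = y" using x y by (simp flip: m_assoc)
        moreover have "inv (x \<otimes> y) \<otimes> h = inv y \<otimes> (inv x \<otimes> h)" using x y h by (simp add: inv_mult m_ac)
        ultimately show "f x * g (inv x \<otimes> (x \<otimes> y)) * k (inv (x \<otimes> y) \<otimes> h) =
            f x * (g y * k (inv y \<otimes> (inv x \<otimes> h)))" by simp
      qed
      finally show "(\<Sum>z\<in>carrier G. f x * g (inv x \<otimes> z) * k (inv z \<otimes> h)) =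
          (\<Sum>y\<in>carrier G. f x * (g y * k (inv y \<otimes> (inv x \<otimes> h))))" .
    qed
    also have "\<dots> = conv f (conv g k) h"
      using h by (simp add: conv_def sum_distrib_left)
    finally show ?thesis .
  qed (simp add: conv_def)
qed

lemma conv_one_left: "conv conv_one f = f"
proof
  fix h
  have "(\<Sum>x\<in>carrier G. conv_one x * f (inv x \<otimes> h)) = (\<Sum>x\<in>{\<one>}. conv_one x * f (inv x \<otimes> h))"
    by (rule sum.mono_neutral_right) (auto simp: conv_one_def)
  then show "conv conv_one f h = f h" by (simp add: conv_def conv_one_def)
qed

lemma conv_add_left: "conv (f + g) k = conv f k + conv g k"
  by (auto simp: conv_def fun_eq_iff distrib_right sum.distrib)

interpretation gr: comm_ring_1 where times = conv and one = conv_one and plus = "(+)"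
  and zero = 0 and minus = "(-)" and uminus = uminus
proof unfold_locales
  show "(0 :: 'a \<Rightarrow> int) \<noteq> conv_one" by (metis zero_neq_one conv_one_def zero_fun_apply)
  show "conv f g = conv g f" for f g by (rule conv_commute)
qed (auto simp: conv_assoc conv_one_left conv_add_left)

lemma gr_of_nat: "gr.of_nat n = (\<lambda>x. int n * conv_one x)"
proof (induction n)
  case 0
  have "gr.of_nat 0 = 0" by (rule gr.of_nat_0)
  then show ?case by (simp only: zero_fun_def of_nat_0 mult_zero_left)
next
  case (Suc n)
  have "gr.of_nat (Suc n) = conv_one + gr.of_nat n" by (rule gr.of_nat_Suc)
  also have "\<dots> = (\<lambda>x. int (Suc n) * conv_one x)" unfolding Suc by (simp add: fun_eq_iff distrib_right)
  finally show ?case .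
qed

lemma gr_of_nat_mult: "conv (gr.of_nat n) f = (\<lambda>x. int n * f x)"
proof -
  have "conv (gr.of_nat n) f = (\<lambda>x. int n * conv conv_one f x)"
    unfolding gr_of_nat conv_def by (simp only: sum_distrib_left mult.assoc if_distrib[of "(*) (int n)"])
  then show ?thesis by (simp add: conv_one_left)
qed

lemma gr_of_nat_dvd_iff: "gr.dvd (gr.of_nat n) f \<longleftrightarrow> (\<forall>x. int n dvd f x)"
proof
  assume "\<forall>x. int n dvd f x"
  then obtain k where "\<And>x. f x = int n * k x" unfolding dvd_def by metis
  then have "f = conv (gr.of_nat n) k" by (auto simp: gr_of_nat_mult)
  then show "gr.dvd (gr.of_nat n) f" unfolding gr.dvd_def by blast
qed (auto simp: gr.dvd_def gr_of_nat_mult)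

section \<open>Monomials and power maps in the group ring\<close>

definition monomial :: "int \<Rightarrow> 'a \<Rightarrow> 'a \<Rightarrow> int" where
  "monomial c a x = (if x = a then c else 0)"

lemma conv_monomial:
  assumes "a \<in> carrier G" "b \<in> carrier G"
  shows "conv (monomial c a) (monomial d b) = monomial (c * d) (a \<otimes> b)"
proof
  fix h
  have "(\<Sum>x\<in>carrier G. monomial c a x * monomial d b (inv x \<otimes> h)) = (\<Sum>x\<in>{a}. monomial c a x * monomial d b (inv x \<otimes> h))"
    using assms by (intro sum.mono_neutral_right) (auto simp: monomial_def)
  moreover have "inv a \<otimes> h = b \<longleftrightarrow> h = a \<otimes> b" if "h \<in> carrier G"
    using assms that by (metis inv_solve_left)
  ultimately show "conv (monomial c a) (monomial d b) h = monomial (c * d) (a \<otimes> b) h"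
    using assms by (auto simp: conv_def monomial_def)
qed

lemma monomial_power:
  assumes "a \<in> carrier G"
  shows "gr.power (monomial c a) (Suc n) = monomial (c ^ Suc n) (a [^] Suc n)"
  by (induction n) (use assms in \<open>simp_all add: conv_monomial m_comm\<close>)

lemma power_outside_carrier: "h \<notin> carrier G \<Longrightarrow> gr.power f n h = f h ^ n"
  by (induction n) (simp_all add: conv_def conv_one_def)

text \<open>When h^(t p) = h on the group, pulling back along h -> h^t sends the basis element a to
  a^p: this is the linear extension of g -> g^p and serves as the Frobenius lift \<psi>.\<close>

definition pow_pullback :: "nat \<Rightarrow> ('a \<Rightarrow> int) \<Rightarrow> 'a \<Rightarrow> int" where
  "pow_pullback t f h = (if h \<in> carrier G then f (h [^] t) else f h)"

lemma pow_pullback_add: "pow_pullback t (f + g) = pow_pullback t f + pow_pullback t g"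
  by (auto simp: pow_pullback_def fun_eq_iff)

lemma pow_pullback_conv:
  assumes "bij_betw (\<lambda>x. x [^] t) (carrier G) (carrier G)"
  shows "pow_pullback t (conv f g) = conv (pow_pullback t f) (pow_pullback t g)"
proof
  fix h
  have "(\<Sum>y\<in>carrier G. f y * g (inv y \<otimes> h [^] t)) =
      (\<Sum>x\<in>carrier G. f (x [^] t) * g ((inv x \<otimes> h) [^] t))" if h: "h \<in> carrier G"
  proof -
    have "(\<Sum>y\<in>carrier G. f y * g (inv y \<otimes> h [^] t)) =
        (\<Sum>x\<in>carrier G. f (x [^] t) * g (inv (x [^] t) \<otimes> h [^] t))"
      by (rule sum.reindex_bij_betw[OF assms, symmetric])
    then show ?thesis using h by (simp add: nat_pow_distrib nat_pow_inv cong: sum.cong)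
  qed
  then show "pow_pullback t (conv f g) h = conv (pow_pullback t f) (pow_pullback t g) h"
    by (simp add: pow_pullback_def conv_def cong: sum.cong)
qed

lemma pow_pullback_one:
  assumes "bij_betw (\<lambda>x. x [^] t) (carrier G) (carrier G)"
  shows "pow_pullback t conv_one = conv_one"
proof -
  have "h [^] t = \<one> \<longleftrightarrow> h = \<one>" if "h \<in> carrier G" for h
    using assms that nat_pow_one[of t] by (metis bij_betw_imp_inj_on inj_onD one_closed)
  then show ?thesis by (auto simp: pow_pullback_def conv_one_def fun_eq_iff)
qed

lemma pow_pullback_funpow: "(pow_pullback t ^^ n) f = pow_pullback (t ^ n) f"
proof (induction n)
  case 0 show ?case by (simp add: pow_pullback_def fun_eq_iff)
next
  case (Suc n)
  then show ?case by (auto simp: pow_pullback_def fun_eq_iff nat_pow_pow)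
qed

text \<open>Both maps are additive modulo p, the p-th power by the freshman's dream, so integer
  multiples of group elements suffice; there the group elements agree exactly and the coefficients
  agree by Fermat.\<close>

lemma pow_pullback_frobenius:
  assumes p: "Factorial_Ring.prime p" and tp: "\<And>x. x \<in> carrier G \<Longrightarrow> x [^] (t * p) = x"
  shows "gr.dvd (gr.of_nat p) (pow_pullback t f - gr.power f p)"
proof -
  have p0: "p = Suc (p - 1)" using prime_gt_0_nat[OF p] by simp
  have "gr.dvd (gr.of_nat p) (pow_pullback t f - gr.power f p)"
    if "finite S" "S \<subseteq> carrier G" "\<And>x. x \<in> carrier G - S \<Longrightarrow> f x = 0" for S f
    using that
  proof (induction S arbitrary: f)
    \<comment> \<open>Here f vanishes on the carrier but is arbitrary outside, where powers are
      pointwise and Fermat applies.\<close>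
    case empty
    have "gr.power f p h = 0" if "h \<in> carrier G" for h
      using that empty by (subst p0) (simp add: conv_def)
    moreover have "f (h [^] t) = 0" if "h \<in> carrier G" for h using that empty by simp
    ultimately show ?case
      using prime_dvd_diff_power_int[OF p] unfolding gr_of_nat_dvd_iff
      by (auto simp: pow_pullback_def power_outside_carrier)
  next
    case (insert a S)
    then have a: "a \<in> carrier G" by simp
    define g where "g = f(a := 0)"
    define m where "m = monomial (f a) a"
    have f: "f = g + m" by (auto simp: g_def m_def monomial_def fun_eq_iff)
    have g_dvd: "gr.dvd (gr.of_nat p) (pow_pullback t g - gr.power g p)"
      using insert by (intro insert.IH) (auto simp: g_def)
    have m_dvd: "gr.dvd (gr.of_nat p) (pow_pullback t m - gr.power m p)"
    proof -
      have "gr.power m p = monomial (f a ^ p) (a [^] p)"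
        using monomial_power[OF a, of "f a" "p - 1"] p0 by (simp add: m_def)
      moreover have "h [^] t = a \<longleftrightarrow> h = a [^] p" if "h \<in> carrier G" for h
        using tp that a by (metis nat_pow_pow mult.commute)
      ultimately show ?thesis using a prime_dvd_diff_power_int[OF p] unfolding gr_of_nat_dvd_iff
        by (auto simp: pow_pullback_def m_def monomial_def)
    qed
    have f_dvd: "gr.dvd (gr.of_nat p) (gr.power f p - (gr.power g p + gr.power m p))"
      unfolding f by (rule gr.freshmans_dream_dvd[OF p])
    have "gr.dvd (gr.of_nat p) (((pow_pullback t g - gr.power g p) + (pow_pullback t m - gr.power m p))
       - (gr.power f p - (gr.power g p + gr.power m p)))"
      by (rule gr.dvd_diff[OF gr.dvd_add[OF g_dvd m_dvd] f_dvd])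
    moreover have "((pow_pullback t g - gr.power g p) + (pow_pullback t m - gr.power m p))
       - (gr.power f p - (gr.power g p + gr.power m p)) = pow_pullback t f - gr.power f p"
      by (simp add: f pow_pullback_add)
    ultimately show ?case by (simp only:)
  qed
  from this[of "carrier G" f] show ?thesis by simp
qed

section \<open>Multipliers of difference sets\<close>

lemma exists_pow_period:
  fixes p :: nat
  assumes "p > 0" "coprime p (order G)"
  obtains e where "e > 0" "\<And>x. x \<in> carrier G \<Longrightarrow> x [^] (p ^ e) = x"
proof
  have v: "order G > 0" using order_gt_0_iff_finite by simp
  show "totient (order G) > 0" using v by simp
  have "[p ^ totient (order G) = 1] (mod (order G))" using assms(2) by (rule euler_theorem)
  fix x assume x: "x \<in> carrier G"
  have "order G dvd p ^ totient (order G) - 1"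
    using \<open>[p ^ totient (order G) = 1] (mod (order G))\<close> by (rule cong_to_1_nat)
  then obtain c where "p ^ totient (order G) - 1 = order G * c" by (rule dvdE)
  moreover have "p ^ totient (order G) > 0" using \<open>p > 0\<close> by simp
  ultimately have "p ^ totient (order G) = Suc (order G * c)" by linarith
  then show "x [^] (p ^ totient (order G)) = x"
    using x by (simp add: pow_order_eq_1 flip: nat_pow_pow)
qed

lemma pow_period_mult:
  fixes p :: nat
  assumes "\<And>x. x \<in> carrier G \<Longrightarrow> x [^] (p ^ e) = x" "x \<in> carrier G"
  shows "x [^] (p ^ (e * n)) = x"
proof (induction n)
  case 0 show ?case using assms by simp
next
  case (Suc n)
  have "x [^] (p ^ (e * Suc n)) = (x [^] (p ^ e)) [^] (p ^ (e * n))"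
    using assms(2) by (simp add: nat_pow_pow power_add)
  then show ?case using Suc assms by simp
qed

text \<open>The exponent p^(e-1) inverts p. Its e-th power is p^(e (e-1)), where e (e-1) is a
  multiple of the period e.\<close>

lemma pow_pullback_funpow_period:
  fixes p :: nat
  assumes "\<And>x. x \<in> carrier G \<Longrightarrow> x [^] (p ^ e) = x"
  shows "(pow_pullback (p ^ (e - 1)) ^^ e) f = f"
proof -
  have "h [^] ((p ^ (e - 1)) ^ e) = h" if "h \<in> carrier G" for h
    using pow_period_mult[of p e h "e - 1"] assms that by (simp add: mult.commute flip: power_mult)
  then show ?thesis by (auto simp: pow_pullback_funpow pow_pullback_def)
qed

text \<open>Convolving with \<open>g\<close> into the functions that are constant modulo \<open>p\<^sup>k\<close> defines an ideal.\<close>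
lemma conv_pow_pullback_cong:
  fixes p k :: nat
  assumes p: "Factorial_Ring.prime p" and "e > 0"
    and period: "\<And>x. x \<in> carrier G \<Longrightarrow> x [^] (p ^ e) = x"
    and cong: "\<And>h. h \<in> carrier G \<Longrightarrow> [conv f g h = c] (mod (int (p ^ k)))"
  obtains c' where "\<And>h. h \<in> carrier G \<Longrightarrow> [conv (pow_pullback (p ^ (e - 1)) f) g h = c'] (mod (int (p ^ k)))"
proof -
  define t where "t = p ^ (e - 1)"
  define I where "I = {f. \<exists>c. \<forall>h\<in>carrier G. [conv f g h = c] (mod (int (p ^ k)))}"
  have tp: "t * p = p ^ e" using \<open>e > 0\<close> by (simp add: t_def flip: power_Suc2)
  have bij: "bij_betw (\<lambda>x. x [^] t) (carrier G) (carrier G)"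
    by (rule bij_betw_byWitness[where f' = "\<lambda>x. x [^] p"])
      (use period tp in \<open>auto simp: nat_pow_pow mult.commute\<close>)
  have "pow_pullback t f \<in> I"
  proof (rule gr.frobenius_lift_in_ideal[where \<psi> = "pow_pullback t" and p = p and k = k and e = e and x = f])
    show "p > 0" using p by (rule prime_gt_0_nat)
    show "pow_pullback t (x + y) = pow_pullback t x + pow_pullback t y" for x y by (rule pow_pullback_add)
    show "pow_pullback t (conv x y) = conv (pow_pullback t x) (pow_pullback t y)" for x y
      by (rule pow_pullback_conv[OF bij])
    show "pow_pullback t conv_one = conv_one" by (rule pow_pullback_one[OF bij])
    show "gr.dvd (gr.of_nat p) (pow_pullback t x - gr.power x p)" for x
      by (rule pow_pullback_frobenius[OF p]) (use tp period in simp)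
    show "(pow_pullback t ^^ e) x = x" for x
      unfolding t_def by (rule pow_pullback_funpow_period[OF period])
    show "e > 0" by fact
    show "x + y \<in> I" if xy: "x \<in> I" "y \<in> I" for x y
    proof -
      from xy obtain c d where "\<forall>h\<in>carrier G. [conv x g h = c] (mod (int (p ^ k)))"
        "\<forall>h\<in>carrier G. [conv y g h = d] (mod (int (p ^ k)))" unfolding I_def by blast
      then have "\<forall>h\<in>carrier G. [conv (x + y) g h = c + d] (mod (int (p ^ k)))"
        unfolding conv_add_left plus_fun_apply by (blast intro: cong_add)
      then show ?thesis unfolding I_def by blast
    qed
    show "conv r x \<in> I" if x: "x \<in> I" for r x
    proof -
      from x obtain c where c: "\<forall>h\<in>carrier G. [conv x g h = c] (mod (int (p ^ k)))"
        unfolding I_def by blast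
      \<comment> \<open>The coefficients of r (x g) are sums of coefficients of x g weighted by r,
        so the new constant is c times the augmentation of r.\<close>
      have "[conv (conv r x) g h = (\<Sum>y\<in>carrier G. r y * c)] (mod (int (p ^ k)))" if h: "h \<in> carrier G" for h
      proof -
        have "conv (conv r x) g h = (\<Sum>y\<in>carrier G. r y * conv x g (inv y \<otimes> h))"
          unfolding conv_assoc by (subst conv_def) (simp add: h)
        also have "[\<dots> = (\<Sum>y\<in>carrier G. r y * c)] (mod (int (p ^ k)))"
          using c h by (intro cong_sum cong_mult cong_refl) auto
        finally show ?thesis .
      qed
      then show ?thesis unfolding I_def by blast
    qed
    have "\<forall>h\<in>carrier G. [conv (gr.of_nat (p ^ k)) g h = 0] (mod (int (p ^ k)))"
      unfolding gr_of_nat_mult by (simp add: cong_0_iff)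
    then show "gr.of_nat (p ^ k) \<in> I" unfolding I_def by blast
    show "f \<in> I" using cong unfolding I_def by blast
  qed
  then show thesis using that unfolding I_def t_def by blast
qed

section \<open>Characteristic functions and the group ring equation of a difference set\<close>

lemma sum_conv: "(\<Sum>h\<in>carrier G. conv f g h) = (\<Sum>h\<in>carrier G. f h) * (\<Sum>h\<in>carrier G. g h)"
proof -
  have "(\<Sum>h\<in>carrier G. conv f g h) = (\<Sum>h\<in>carrier G. \<Sum>x\<in>carrier G. f x * g (inv x \<otimes> h))"
    by (simp add: conv_def)
  also have "\<dots> = (\<Sum>x\<in>carrier G. \<Sum>h\<in>carrier G. f x * g (inv x \<otimes> h))" by (rule sum.swap)
  also have "\<dots> = (\<Sum>x\<in>carrier G. f x * (\<Sum>h\<in>carrier G. g h))"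
    using sum_translate[of "inv _" g] by (simp flip: sum_distrib_left)
  finally show ?thesis by (simp add: sum_distrib_right)
qed

abbreviation char_fun :: "'a set \<Rightarrow> 'a \<Rightarrow> int" where
  "char_fun A \<equiv> (\<lambda>x. of_bool (x \<in> A))"

lemma sum_char_fun: "A \<subseteq> carrier G \<Longrightarrow> (\<Sum>x\<in>carrier G. char_fun A x) = int (card A)"
  by (simp add: sum_of_bool_eq Int_absorb1)

text \<open>Two different sets are allowed, since the multiplier argument compares D with the set of
  its p-th powers.\<close>

lemma conv_char_fun_inverse:
  assumes "A \<subseteq> carrier G" "B \<subseteq> carrier G" "h \<in> carrier G"
  shows "conv (char_fun A) (char_fun (m_inv G ` B)) h = int (card {x \<in> A. inv h \<otimes> x \<in> B})"
proof -
  have "inv x \<otimes> h \<in> m_inv G ` B \<longleftrightarrow> inv h \<otimes> x \<in> B" if "x \<in> carrier G" for x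
  proof -
    have "inv (inv h \<otimes> x) = inv x \<otimes> h" using that assms by (simp add: inv_mult m_comm)
    moreover have "inv x \<otimes> h = inv (inv h \<otimes> x)" using that assms by (simp add: inv_mult m_comm)
    ultimately show ?thesis using inj_on_image_mem_iff[OF inv_inj _ assms(2), of "inv h \<otimes> x"] that assms by simp
  qed
  then have "conv (char_fun A) (char_fun (m_inv G ` B)) h = (\<Sum>x\<in>carrier G. of_bool (x \<in> A \<and> inv h \<otimes> x \<in> B))"
    using assms by (simp add: conv_def of_bool_conj)
  also have "\<dots> = int (card {x \<in> A. inv h \<otimes> x \<in> B})"
    using assms by (auto simp: sum_of_bool_eq intro!: arg_cong[where f = card])
  finally show ?thesis .
qed

lemma difference_set_conv:
  assumes D: "difference_set G D v k lam" and h: "h \<in> carrier G"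
  shows "conv (char_fun D) (char_fun (m_inv G ` D)) h = (if h = \<one> then int k else int lam)"
proof -
  have DG: "D \<subseteq> carrier G" and k: "card D = k" using D by (auto simp: difference_set_def)
  have "card {x \<in> D. inv h \<otimes> x \<in> D} = card {(d1, d2). d1 \<in> D \<and> d2 \<in> D \<and> d1 \<otimes> inv d2 = h}"
  proof (rule bij_betw_same_card)
    have "d1 \<otimes> inv d2 = h \<longleftrightarrow> d2 = inv h \<otimes> d1" if "d1 \<in> D" "d2 \<in> D" for d1 d2
    proof -
      have "d1 \<in> carrier G" "d2 \<in> carrier G" using that DG by auto
      then have "h = d1 \<otimes> inv d2 \<longleftrightarrow> d2 = inv h \<otimes> d1"
        using h by (simp add: inv_solve_left inv_solve_right)
      then show ?thesis by (simp only: eq_commute)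
    qed
    then have pairs: "{(d1, d2). d1 \<in> D \<and> d2 \<in> D \<and> d1 \<otimes> inv d2 = h} =
        {(d1, d2). d1 \<in> D \<and> d2 \<in> D \<and> d2 = inv h \<otimes> d1}" by blast
    show "bij_betw (\<lambda>x. (x, inv h \<otimes> x)) {x \<in> D. inv h \<otimes> x \<in> D} {(d1, d2). d1 \<in> D \<and> d2 \<in> D \<and> d1 \<otimes> inv d2 = h}"
      unfolding pairs by (rule bij_betw_byWitness[where f' = fst]) auto
  qed
  moreover have "{x \<in> D. inv \<one> \<otimes> x \<in> D} = D" using DG by auto
  ultimately have "card {x \<in> D. inv h \<otimes> x \<in> D} = (if h = \<one> then k else lam)"
    using D h k by (auto simp: difference_set_def)
  then show ?thesis using conv_char_fun_inverse[OF DG DG h] by simp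
qed

text \<open>Take the augmentation of both sides of \<open>difference_set_conv\<close>, that is, sum
  all coefficients.\<close>

lemma difference_set_parameters:
  assumes D: "difference_set G D v k lam"
  shows "int k * int k = int lam * int v + (int k - int lam)"
proof -
  have DG: "D \<subseteq> carrier G" and k: "card D = k" and v: "card (carrier G) = v"
    using D by (auto simp: difference_set_def)
  have "inj_on (m_inv G) D" using DG by (intro inj_onI) (metis inv_inv subsetD)
  then have k': "card (m_inv G ` D) = k" using k by (simp add: card_image)
  have "int k * int k = (\<Sum>h\<in>carrier G. conv (char_fun D) (char_fun (m_inv G ` D)) h)"
    unfolding sum_conv using DG k k' by (subst (1 2) sum_char_fun) auto
  also have "\<dots> = (\<Sum>h\<in>carrier G. (if h = \<one> then int k - int lam else 0) + int lam)"
    using difference_set_conv[OF D] by (intro sum.cong) auto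
  also have "\<dots> = int lam * int v + (int k - int lam)"
    using v by (simp add: sum.distrib mult.commute)
  finally show ?thesis .
qed

lemma finprod_pow:
  assumes "f \<in> A \<rightarrow> carrier G"
  shows "(\<Otimes>x\<in>A. f x [^] (n :: nat)) = (\<Otimes>x\<in>A. f x) [^] n"
  using assms by (induction n) (simp_all add: finprod_multf Pi_iff)

text \<open>The multiplier argument. Let A be the p-th powers of D and n = p^j = k - lam. The
  coefficients N of A D^-1 are congruent to lam modulo n, hence at least lam, and their total
  exceeds lam |G| by n. So some coefficient is at least lam + n = k = |A|, which forces a translate
  of A into D.\<close>

lemma difference_set_pow_translate:
  fixes p j :: nat
  assumes p: "Factorial_Ring.prime p" and cop: "coprime p (order G)"
    and D: "difference_set G D (order G) k lam"
    and k: "k = lam + p ^ j" and lam: "lam < p ^ j"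
  obtains h where "h \<in> carrier G" "\<And>d. d \<in> D \<Longrightarrow> h \<otimes> d [^] p \<in> D"
proof -
  let ?n = "int (p ^ j)"
  have p0: "p > 0" using p by (rule prime_gt_0_nat)
  obtain e where e: "e > 0" and period: "\<And>x. x \<in> carrier G \<Longrightarrow> x [^] (p ^ e) = x"
    using exists_pow_period[OF p0 cop] by blast
  define t where "t = p ^ (e - 1)"
  have tp: "t * p = p ^ e" using \<open>e > 0\<close> by (simp add: t_def flip: power_Suc2)
  have DG: "D \<subseteq> carrier G" and cardD: "card D = k" using D by (auto simp: difference_set_def)
  have fin: "finite D" using DG finite_subset finite_carrier by blast
  define A where "A = (\<lambda>d. d [^] p) ` D"
  have AG: "A \<subseteq> carrier G" using DG by (auto simp: A_def)
  have pt: "(x [^] p) [^] t = x" "(x [^] t) [^] p = x" if "x \<in> carrier G" for x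
    using that period tp by (simp_all add: nat_pow_pow mult.commute)
  have "inj_on (\<lambda>d. d [^] p) D" using pt DG by (intro inj_onI) (metis subsetD)
  then have cardA: "card A = k" using cardD by (simp add: A_def card_image)
  \<comment> \<open>A is cut out by the condition that x^t lies in D, so its characteristic function
    is the Frobenius lift of that of D.\<close>
  have "x \<in> A \<longleftrightarrow> x [^] t \<in> D" if "x \<in> carrier G" for x
    unfolding A_def image_iff using pt that DG by (metis subsetD)
  then have A: "pow_pullback t (char_fun D) = char_fun A"
    using AG DG by (auto simp: pow_pullback_def fun_eq_iff)
  define N where "N = conv (char_fun A) (char_fun (m_inv G ` D))"
  have N: "N h = int (card {x \<in> A. inv h \<otimes> x \<in> D})" if "h \<in> carrier G" for h
    unfolding N_def by (rule conv_char_fun_inverse[OF AG DG that])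
  have "[conv (char_fun D) (char_fun (m_inv G ` D)) h = int lam] (mod ?n)" if "h \<in> carrier G" for h
    using difference_set_conv[OF D that] by (auto simp: k cong_def)
  then obtain c where c: "\<And>h. h \<in> carrier G \<Longrightarrow> [N h = c] (mod ?n)"
    using conv_pow_pullback_cong[OF p e period] unfolding N_def A[symmetric] t_def by metis
  have "inj_on (m_inv G) D" using DG inv_inj inj_on_subset by blast
  then have k': "card (m_inv G ` D) = k" using cardD by (simp add: card_image)
  have sumN: "(\<Sum>h\<in>carrier G. N h) = int lam * int (order G) + ?n"
    unfolding N_def sum_conv using AG DG k' cardA difference_set_parameters[OF D]
    by (subst (1 2) sum_char_fun) (auto simp: k)
  \<comment> \<open>Summing over G identifies the constant: the total is lam |G| modulo n, and |G|
    is invertible there.\<close>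
  have "[int (order G) * c = int (order G) * int lam] (mod ?n)"
  proof -
    have "[int (order G) * c = (\<Sum>h\<in>carrier G. N h)] (mod ?n)"
      using cong_sum[of "carrier G" "\<lambda>_. c" N ?n] c by (simp add: order_def cong_sym)
    then show ?thesis by (simp add: sumN cong_def mult.commute)
  qed
  moreover have "coprime (int (order G)) ?n" using cop by (simp add: coprime_commute)
  ultimately have c_lam: "[c = int lam] (mod ?n)" by (simp add: cong_mult_lcancel)
  have lower: "int lam \<le> N h" if "h \<in> carrier G" for h
  proof -
    have "[N h = int lam] (mod ?n)" using c[OF that] c_lam cong_trans by blast
    then have "N h mod ?n = int lam" using lam by (simp add: cong_def)
    moreover have "N h mod ?n \<le> N h" using N[OF that] by (intro zmod_le_nonneg_dividend) simp
    ultimately show ?thesis by simp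
  qed
  \<comment> \<open>If no coefficient exceeded lam, the total would be at most lam |G|,
    contradicting \<open>sumN\<close>.\<close>
  obtain h where h: "h \<in> carrier G" "N h > int lam"
  proof (rule ccontr)
    assume "\<not> thesis"
    then have "N h \<le> int lam" if "h \<in> carrier G" for h using that \<open>\<And>h. h \<in> carrier G \<Longrightarrow> N h > int lam \<Longrightarrow> thesis\<close> not_le by blast
    then have "(\<Sum>h\<in>carrier G. N h) \<le> (\<Sum>h\<in>carrier G. int lam)" by (rule sum_mono)
    moreover have "0 < ?n" using p0 by simp
    ultimately show False by (simp add: sumN order_def mult.commute del: of_nat_power)
  qed
  have "?n dvd N h - int lam" using c[OF h(1)] c_lam cong_trans cong_iff_dvd_diff by blast
  then have "?n \<le> N h - int lam" using h by (intro zdvd_imp_le) auto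
  then have "int (lam + p ^ j) \<le> int (card {x \<in> A. inv h \<otimes> x \<in> D})" using N[OF h(1)] by simp
  then have "card A \<le> card {x \<in> A. inv h \<otimes> x \<in> D}" unfolding cardA k of_nat_le_iff .
  moreover have "finite A" using fin by (simp add: A_def)
  ultimately have "{x \<in> A. inv h \<otimes> x \<in> D} = A" by (intro card_seteq) auto
  then have "inv h \<otimes> d [^] p \<in> D" if "d \<in> D" for d using that by (auto simp: A_def)
  then show thesis using that[of "inv h"] h by simp
qed

text \<open>The map d -> h d^p of \<open>difference_set_pow_translate\<close> permutes D. Comparing
  the products over D, which is 1 by normalization, leaves h^k = 1; as k is prime to |G|, h =
  1.\<close>

lemma normalized_difference_set_pow_closed:
  fixes p j :: nat
  assumes p: "Factorial_Ring.prime p" and cop: "coprime p (order G)" "coprime k (order G)"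
    and D: "difference_set G D (order G) k lam" "normalized G D"
    and k: "k = lam + p ^ j" and lam: "lam < p ^ j"
    and d: "d \<in> D"
  shows "d [^] p \<in> D"
proof -
  obtain h where h: "h \<in> carrier G" "\<And>d. d \<in> D \<Longrightarrow> h \<otimes> d [^] p \<in> D"
    using difference_set_pow_translate[OF p cop(1) D(1) k lam] by blast
  have DG: "D \<subseteq> carrier G" and cardD: "card D = k" using D by (auto simp: difference_set_def)
  have fin: "finite D" using DG finite_subset finite_carrier by blast
  have prod: "(\<Otimes>d\<in>D. d) = \<one>" using D by (simp add: normalized_def)
  obtain e where period: "\<And>x. x \<in> carrier G \<Longrightarrow> x [^] (p ^ e) = x" and "e > 0"
    using exists_pow_period[OF prime_gt_0_nat[OF p] cop(1)] by blast
  then have pt: "(x [^] p) [^] (p ^ (e - 1)) = x" if "x \<in> carrier G" for x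
    using that by (simp add: nat_pow_pow flip: power_Suc)
  have inj: "inj_on (\<lambda>d. h \<otimes> d [^] p) D"
  proof (rule inj_onI)
    fix x y assume xy: "x \<in> D" "y \<in> D" "h \<otimes> x [^] p = h \<otimes> y [^] p"
    then have "x [^] p = y [^] p" using h DG by (simp add: subset_eq)
    then show "x = y" using pt xy DG by (metis subsetD)
  qed
  have img: "(\<lambda>d. h \<otimes> d [^] p) ` D = D"
    using h(2) fin by (intro card_seteq) (auto simp: card_image[OF inj])
  have "(\<Otimes>d\<in>D. d) = (\<Otimes>d\<in>D. h \<otimes> d [^] p)"
    using finprod_reindex[OF _ inj, of "\<lambda>d. d"] DG unfolding img by auto
  also have "\<dots> = (\<Otimes>d\<in>D. h) \<otimes> (\<Otimes>d\<in>D. d [^] p)"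
    using h DG by (intro finprod_multf) auto
  also have "\<dots> = h [^] k \<otimes> (\<Otimes>d\<in>D. d) [^] p"
    using h DG finprod_pow[of "\<lambda>d. d" D p] cardD by (simp add: finprod_const Pi_iff subset_eq)
  finally have "h [^] k = \<one>" using h by (simp add: prod)
  then have "ord h dvd k" using h by (simp add: pow_eq_id)
  moreover have "ord h dvd order G" using h by (simp add: ord_dvd_group_order)
  ultimately have "ord h = 1" using cop(2) by (metis coprime_common_divisor_nat)
  then have "h [^] (1 :: nat) = \<one>" using h by (simp only: pow_eq_id dvd_refl)
  then have "h = \<one>" using h by simp
  then show ?thesis using h(2)[OF d] d DG by auto
qed

section \<open>Intersections with cosets\<close>

text \<open>The group algebra over F_p is reduced because p does not divide |G|: this is
  \<open>prime_power_dvd_of_dvd_square\<close> for the Frobenius lift \<open>pow_pullback\<close>,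
  with integer coefficients allowing cancellation of p.\<close>

lemma prime_power_dvd_conv_self:
  fixes p m :: nat
  assumes p: "Factorial_Ring.prime p" and cop: "coprime p (order G)"
    and dvd: "\<And>h. int (p ^ (2 * m)) dvd conv f f h"
  shows "int (p ^ m) dvd f x"
proof -
  have p0: "p > 0" using p by (rule prime_gt_0_nat)
  obtain e where e: "e > 0" and period: "\<And>x. x \<in> carrier G \<Longrightarrow> x [^] (p ^ e) = x"
    using exists_pow_period[OF p0 cop] by blast
  have tp: "p ^ (e - 1) * p = p ^ e" using e by (simp flip: power_Suc2)
  have "gr.dvd (gr.of_nat (p ^ m)) f"
  proof (rule gr.prime_power_dvd_of_dvd_square[where \<psi> = "pow_pullback (p ^ (e - 1))" and e = e])
    show "1 < p" using p by (rule prime_gt_1_nat)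
    show "gr.dvd (gr.of_nat p) (pow_pullback (p ^ (e - 1)) x - gr.power x p)" for x
      by (rule pow_pullback_frobenius[OF p]) (use tp period in simp)
    show "(pow_pullback (p ^ (e - 1)) ^^ e) x = x" for x
      by (rule pow_pullback_funpow_period[OF period])
    show "e > 0" by fact
    show "x = y" if "conv (gr.of_nat p) x = conv (gr.of_nat p) y" for x y
    proof
      fix h
      show "x h = y h" using fun_cong[OF that, of h] p0 unfolding gr_of_nat_mult by simp
    qed
    show "gr.dvd (gr.of_nat (p ^ (2 * m))) (conv f f)" unfolding gr_of_nat_dvd_iff using dvd by blast
  qed
  then show ?thesis unfolding gr_of_nat_dvd_iff by blast
qed

lemma mem_rcos_iff:
  assumes "subgroup L G" "x \<in> carrier G" "y \<in> carrier G"
  shows "y \<in> L #> x \<longleftrightarrow> inv y \<otimes> x \<in> L"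
proof -
  have "y \<in> L #> x \<longleftrightarrow> y \<otimes> inv x \<in> L"
    using subgroup.rcos_module[OF assms(1) is_group assms(2,3)] .
  moreover have "inv (y \<otimes> inv x) = inv y \<otimes> x" "inv (inv y \<otimes> x) = y \<otimes> inv x"
    using assms by (simp_all add: inv_mult)
  ultimately show ?thesis using assms(1) by (metis subgroup.m_inv_closed)
qed

text \<open>Coset counts remain functions on G, constant on cosets of L, in place of elements of the
  group ring of G/L.\<close>

lemma conv_char_fun_subgroup:
  assumes L: "subgroup L G" and A: "A \<subseteq> carrier G" and x: "x \<in> carrier G"
  shows "conv (char_fun A) (char_fun L) x = int (card (A \<inter> (L #> x)))"
proof -
  have "conv (char_fun A) (char_fun L) x = (\<Sum>y\<in>carrier G. of_bool (y \<in> A \<inter> (L #> x)))"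
    unfolding conv_def if_P[OF x] by (rule sum.cong) (auto simp: mem_rcos_iff[OF L x])
  also have "\<dots> = int (card (A \<inter> (L #> x)))" using A by (intro sum_char_fun) auto
  finally show ?thesis .
qed

lemma conv_char_fun_subgroup_self:
  assumes L: "subgroup L G"
  shows "conv (char_fun L) (char_fun L) = (\<lambda>x. int (card L) * char_fun L x)"
proof
  fix x
  have LG: "L \<subseteq> carrier G" using L by (rule subgroup.subset)
  show "conv (char_fun L) (char_fun L) x = int (card L) * char_fun L x"
  proof (cases "x \<in> carrier G")
    case x: True
    have "L \<inter> (L #> x) = (if x \<in> L then L else {})"
    proof (cases "x \<in> L")
      case True then show ?thesis using coset_join2[OF x L] by simp
    next
      case False
      have "y \<notin> L #> x" if "y \<in> L" for y
      proof
        assume "y \<in> L #> x"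
        then have "y \<otimes> (inv y \<otimes> x) \<in> L"
          using that mem_rcos_iff[OF L x] LG L by (metis subgroup.m_closed subsetD)
        then show False using False that LG x by (simp add: subset_eq flip: m_assoc)
      qed
      then show ?thesis using False by auto
    qed
    then show ?thesis using conv_char_fun_subgroup[OF L LG x] by simp
  qed (use LG in \<open>auto simp: conv_def\<close>)
qed

text \<open>Since d^q d lies in L, inv (d^q) lies in the same coset of L as d. As d -> d^q permutes
  D, the map d -> inv (d^q) carries D onto D^-1 coset by coset.\<close>

lemma card_inter_rcos_inverse:
  fixes q :: nat
  assumes L: "subgroup L G" and exponent: "\<And>x. x \<in> carrier G \<Longrightarrow> x [^] (q + 1) \<in> L"
    and D: "D \<subseteq> carrier G" "\<And>d. d \<in> D \<Longrightarrow> d [^] q \<in> D" "inj_on (\<lambda>d. d [^] q) D"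
    and x: "x \<in> carrier G"
  shows "card (D \<inter> (L #> x)) = card (m_inv G ` D \<inter> (L #> x))"
proof -
  have fin: "finite D" using D finite_subset finite_carrier by blast
  have img: "(\<lambda>d. d [^] q) ` D = D"
    using D(2) fin by (intro card_seteq) (auto simp: card_image[OF D(3)])
  have iff: "inv d \<otimes> x \<in> L \<longleftrightarrow> d [^] q \<otimes> x \<in> L" if "d \<in> D" for d
  proof -
    have d: "d \<in> carrier G" using that D by auto
    have 1: "d [^] q \<otimes> x = d [^] (q + 1) \<otimes> (inv d \<otimes> x)"
      using d x by (simp add: m_assoc) (simp flip: m_assoc)
    have 2: "inv d \<otimes> x = inv (d [^] (q + 1)) \<otimes> (d [^] q \<otimes> x)"
      by (rule inv_solve_left[THEN iffD2, OF _ _ _ 1]) (use d x in auto)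
    show ?thesis using 1 2 exponent[OF d] L by (metis subgroup.m_closed subgroup.m_inv_closed)
  qed
  have "bij_betw (\<lambda>d. inv (d [^] q)) (D \<inter> (L #> x)) (m_inv G ` D \<inter> (L #> x))"
  proof (rule bij_betw_imageI)
    show "inj_on (\<lambda>d. inv (d [^] q)) (D \<inter> (L #> x))"
    proof (rule inj_onI)
      fix a b assume ab: "a \<in> D \<inter> (L #> x)" "b \<in> D \<inter> (L #> x)" "inv (a [^] q) = inv (b [^] q)"
      then have "a [^] q = b [^] q" using D(1) by (metis IntD1 inv_inv nat_pow_closed subsetD)
      then show "a = b" using ab D(3) by (auto dest: inj_onD)
    qed
    have mem: "inv (d [^] q) \<in> L #> x \<longleftrightarrow> d \<in> L #> x" if "d \<in> D" for d
    proof -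
      have "d \<in> carrier G" using that D by auto
      then show ?thesis using iff[OF that] mem_rcos_iff[OF L x] by simp
    qed
    have "m_inv G ` D = (\<lambda>d. inv (d [^] q)) ` D" by (subst img[symmetric]) (simp add: image_image)
    then show "(\<lambda>d. inv (d [^] q)) ` (D \<inter> (L #> x)) = m_inv G ` D \<inter> (L #> x)"
      using mem by auto
  qed
  then show ?thesis by (rule bij_betw_same_card)
qed

lemma card_inverse_inter_rcos:
  assumes L: "subgroup L G" and D: "D \<subseteq> carrier G" and x: "x \<in> carrier G"
  shows "card (m_inv G ` D \<inter> (L #> inv x)) = card (D \<inter> (L #> x))"
proof -
  have "inv d \<in> L #> inv x \<longleftrightarrow> d \<in> L #> x" if "d \<in> D" for d
  proof -
    have d: "d \<in> carrier G" using that D by auto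
    have "inv d \<in> L #> inv x \<longleftrightarrow> inv (inv d) \<otimes> inv x \<in> L"
      using d x by (intro mem_rcos_iff L) auto
    also have "\<dots> \<longleftrightarrow> d \<in> L #> x"
      unfolding subgroup.rcos_module[OF L is_group x d] inv_inv[OF d] ..
    finally show ?thesis .
  qed
  then have "m_inv G ` D \<inter> (L #> inv x) = m_inv G ` (D \<inter> (L #> x))" by auto
  moreover have "inj_on (m_inv G) (D \<inter> (L #> x))" by (rule inj_on_subset[OF inv_inj]) (use D in auto)
  ultimately show ?thesis by (simp add: card_image)
qed

lemma card_rcos:
  assumes "subgroup L G" "x \<in> carrier G"
  shows "card (L #> x) = card L"
  using card_rcosets_equal rcosetsI subgroup.subset assms by metis

text \<open>As k + q = (q + 1)^2, c is the average coset count that q further elements would give.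
  Functions live on G, so each coset counts |L| times: with E = q e, the sum of e is -|L| and that
  of e^2 is |L|, while e is constant on cosets.\<close>

lemma difference_set_rcoset_intersections:
  fixes p m q c :: nat
  assumes p: "Factorial_Ring.prime p" and q: "q = p ^ m"
    and cop: "coprime p (order G)" and v: "order G = (q + 1) * (q ^ 2 + 1)"
    and D: "difference_set G D (order G) (q ^ 2 + q + 1) (q + 1)"
    and Dq: "\<And>d. d \<in> D \<Longrightarrow> d [^] q \<in> D" "inj_on (\<lambda>d. d [^] q) D"
    and L: "subgroup L G" and exponent: "\<And>x. x \<in> carrier G \<Longrightarrow> x [^] (q + 1) \<in> L"
    and c: "c * card (rcosets L) = (q + 1) ^ 2"
  obtains x0 where "x0 \<in> carrier G"
    "\<forall>x\<in>carrier G. int (card (D \<inter> (L #> x))) = int c - (if x \<in> L #> x0 then int q else 0)"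
proof -
  have DG: "D \<subseteq> carrier G" and cardD: "card D = q ^ 2 + q + 1" using D by (auto simp: difference_set_def)
  have LG: "L \<subseteq> carrier G" using L by (rule subgroup.subset)
  have q0: "q > 0" using q prime_gt_0_nat[OF p] by simp
  define k where "k = int (q ^ 2 + q + 1)"
  define l where "l = int (card L)"
  define w where "w = int (card (rcosets L))"
  have w: "w * l = int (order G)" unfolding w_def l_def using lagrange[OF L] by (metis of_nat_mult)
  have cw: "int c * w = (int q + 1) ^ 2" using c unfolding w_def by (metis of_nat_mult of_nat_power of_nat_add of_nat_1)
  have vq: "int (order G) = (int q + 1) * (int q ^ 2 + 1)" by (simp add: v algebra_simps)
  have "order G \<noteq> 0" using v by simp
  then have w0: "w \<noteq> 0" using w by auto
  have l0: "l > 0" unfolding l_def using L by (simp add: subgroup.finite_imp_card_positive)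
  have sumL: "(\<Sum>x\<in>carrier G. char_fun L x) = l" unfolding l_def by (rule sum_char_fun[OF LG])
  have sumD: "(\<Sum>x\<in>carrier G. char_fun D x) = k" unfolding k_def sum_char_fun[OF DG] cardD ..

  define P where "P = conv (char_fun D) (char_fun L)"
  define C where "C = (\<lambda>x. int c * char_fun (carrier G) x)"
  have P: "P x = int (card (D \<inter> (L #> x)))" if "x \<in> carrier G" for x
    unfolding P_def by (rule conv_char_fun_subgroup[OF L DG that])
  have DG': "m_inv G ` D \<subseteq> carrier G" using DG by auto
  \<comment> \<open>D and D^-1 have the same coset counts, so P can also be built from D^-1, and P P
    = (D D^-1) (L L).\<close>
  have P': "P = conv (char_fun (m_inv G ` D)) (char_fun L)"
  proof
    fix x
    show "P x = conv (char_fun (m_inv G ` D)) (char_fun L) x"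
    proof (cases "x \<in> carrier G")
      case True
      then show ?thesis
        using P conv_char_fun_subgroup[OF L DG' True] card_inter_rcos_inverse[OF L exponent DG Dq True] by simp
    next
      case False
      then show ?thesis using LG by (auto simp: P_def conv_def)
    qed
  qed
  have sumP: "(\<Sum>x\<in>carrier G. P x) = k * l" unfolding P_def sum_conv sumL sumD ..
  have sumC: "(\<Sum>x\<in>carrier G. C x) = int c * int (order G)" by (simp add: C_def order_def)
  have C_conv: "conv C f h = int c * (\<Sum>x\<in>carrier G. f x)" if h: "h \<in> carrier G" for f h
  proof -
    have "conv C f h = conv f C h" by (simp only: conv_commute)
    also have "\<dots> = (\<Sum>x\<in>carrier G. f x * int c)" using h by (simp add: conv_def C_def)
    finally show ?thesis by (simp add: sum_distrib_left mult.commute)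
  qed
  have PP: "conv P P h = l * (int (q + 1) * l + int q ^ 2 * char_fun L h)" if h: "h \<in> carrier G" for h
  proof -
    let ?DD = "conv (char_fun D) (char_fun (m_inv G ` D))"
    have "conv P P = conv P (conv (char_fun (m_inv G ` D)) (char_fun L))" by (subst (2) P') (rule refl)
    also have "\<dots> = conv ?DD (conv (char_fun L) (char_fun L))"
      unfolding P_def by (simp only: gr.mult.assoc gr.mult.left_commute)
    finally have *: "conv P P = conv ?DD (\<lambda>x. l * char_fun L x)"
      unfolding conv_char_fun_subgroup_self[OF L] l_def .
    have "conv P P h = (\<Sum>y\<in>carrier G. ?DD y * (l * char_fun L (inv y \<otimes> h)))"
      unfolding * by (subst conv_def) (simp only: h if_True)
    \<comment> \<open>D D^-1 is q + 1 everywhere plus an extra q^2 at the identity.\<close>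
    also have "\<dots> = (\<Sum>y\<in>carrier G. l * (int (q + 1) * char_fun L (inv y \<otimes> h)) +
        (if y = \<one> then l * (int q ^ 2 * char_fun L h) else 0))"
      using difference_set_conv[OF D] h by (intro sum.cong) (auto simp: algebra_simps)
    also have "\<dots> = l * (int (q + 1) * (\<Sum>y\<in>carrier G. char_fun L (inv y \<otimes> h))) + l * (int q ^ 2 * char_fun L h)"
      by (simp add: sum.distrib sum_distrib_left del: sum_of_bool_eq sum_mult_of_bool_eq)
    also have "(\<Sum>y\<in>carrier G. char_fun L (inv y \<otimes> h)) = l"
      using sum_inverse[of "\<lambda>y. char_fun L (y \<otimes> h)"] sum_translate[OF h, of "char_fun L"] h sumL
      by (simp add: m_comm del: sum_of_bool_eq cong: sum.cong)
    finally show ?thesis by (simp add: algebra_simps)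
  qed

  define E where "E = P - C"
  have EE: "conv E E h = int q ^ 2 * l * char_fun L h" if h: "h \<in> carrier G" for h
  proof -
    have "conv E E = conv P P - conv C P - (conv C P - conv C C)"
      unfolding E_def by (simp only: gr.left_diff_distrib gr.right_diff_distrib conv_commute[of P C])
    then have "conv E E h = conv P P h - conv C P h - (conv C P h - conv C C h)" by simp
    also have "\<dots> = l * (int (q + 1) * l + int q ^ 2 * char_fun L h) - 2 * (int c * (k * l)) + int c ^ 2 * int (order G)"
      using PP[OF h] C_conv[OF h] sumP sumC by (simp add: power2_eq_square)
    \<comment> \<open>Multiplying by w^2 allows w l = |G| and c w = (q + 1)^2 to be substituted
      without division; w is cancelled at the end.\<close>
    finally have "w ^ 2 * conv E E h = w ^ 2 * (l * (int (q + 1) * l + int q ^ 2 * char_fun L h)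
        - 2 * (int c * (k * l)) + int c ^ 2 * int (order G))" by (rule arg_cong)
    also have "\<dots> = (int q + 1) * (w * l) ^ 2 + w ^ 2 * (int q ^ 2 * l * char_fun L h)
        - 2 * (int c * w) * k * (w * l) + (int c * w) ^ 2 * int (order G)"
      by (simp add: algebra_simps power2_eq_square)
    also have "\<dots> = w ^ 2 * (int q ^ 2 * l * char_fun L h)"
      unfolding w cw vq k_def by (simp add: algebra_simps power2_eq_square)
    finally show ?thesis using w0 by simp
  qed
  have E_out: "E x = 0" if "x \<notin> carrier G" for x
    using that DG by (auto simp: E_def P_def C_def conv_def)
  have "int q dvd E x" for x
  proof -
    have "int (p ^ (2 * m)) dvd conv E E h" for h
    proof (cases "h \<in> carrier G")
      case True
      have "int (p ^ (2 * m)) = int q ^ 2" by (simp add: q mult.commute power_mult)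
      then show ?thesis using EE[OF True] by (simp add: mult.assoc)
    next
      case False
      then show ?thesis using E_out by (simp add: conv_def)
    qed
    then show ?thesis using prime_power_dvd_conv_self[OF p cop] q by blast
  qed
  then obtain e where e: "\<And>x. E x = int q * e x" unfolding dvd_def by metis
  \<comment> \<open>The coefficient of E E at the identity is the sum of squares, because E is
    invariant under inversion.\<close>
  have "conv E E \<one> = (\<Sum>x\<in>carrier G. E x * E (inv x))" by (simp add: conv_def)
  moreover have "E (inv x) = E x" if "x \<in> carrier G" for x
  proof -
    have "card (D \<inter> (L #> inv x)) = card (D \<inter> (L #> x))"
      using card_inter_rcos_inverse[OF L exponent DG Dq, of "inv x"] card_inverse_inter_rcos[OF L DG that] that by simp
    then show ?thesis using P[OF that] P[of "inv x"] that by (simp add: E_def C_def)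
  qed
  ultimately have "(\<Sum>x\<in>carrier G. E x ^ 2) = int q ^ 2 * l"
    using EE[of \<one>] subgroup.one_closed[OF L] by (simp add: power2_eq_square)
  then have "int q ^ 2 * (\<Sum>x\<in>carrier G. e x ^ 2) = int q ^ 2 * l"
    by (simp add: e power_mult_distrib sum_distrib_left)
  then have sum_sq: "(\<Sum>x\<in>carrier G. e x ^ 2) = l" using q0 by simp
  \<comment> \<open>Here k - (q + 1)^2 = -q gives the sum of E, again after scaling by the index
    w.\<close>
  have "w * (\<Sum>x\<in>carrier G. E x) = k * (w * l) - int c * w * int (order G)"
    using sumP sumC by (simp add: E_def sum_subtractf algebra_simps)
  also have "\<dots> = - int q * (w * l)" unfolding w cw vq k_def by (simp add: algebra_simps power2_eq_square)
  finally have "w * (int q * (\<Sum>x\<in>carrier G. e x)) = w * (int q * (- l))"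
    by (simp add: e sum_distrib_left algebra_simps)
  then have sum_e: "(\<Sum>x\<in>carrier G. e x) = - l" using w0 q0 unfolding mult_cancel_left by simp
  obtain x0 where x0: "x0 \<in> carrier G" "e x0 \<noteq> 0"
    using sum_e l0 by (metis neg_equal_0_iff_equal order_less_irrefl sum.neutral)
  have coset: "e x = e x0" if "x \<in> L #> x0" for x
  proof -
    have x: "x \<in> carrier G" using that LG x0 r_coset_subset_G by blast
    have "L #> x = L #> x0" using repr_independence[OF that x0(1) L] by simp
    then have "E x = E x0" using P[OF x] P[OF x0(1)] x x0 by (simp add: E_def C_def)
    then show ?thesis using q0 by (simp add: e)
  qed
  have sub: "L #> x0 \<subseteq> carrier G" using LG x0 r_coset_subset_G by blast
  have card: "int (card (L #> x0)) = l" using card_rcos[OF L x0(1)] by (simp add: l_def)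
  have split: "(\<Sum>x\<in>carrier G. f (e x)) = (\<Sum>x\<in>carrier G - (L #> x0). f (e x)) + l * f (e x0)" for f :: "int \<Rightarrow> int"
  proof -
    have "(\<Sum>x\<in>carrier G. f (e x)) = (\<Sum>x\<in>carrier G - (L #> x0). f (e x)) + (\<Sum>x\<in>L #> x0. f (e x))"
      by (rule sum.subset_diff[OF sub finite_carrier])
    then show ?thesis using card coset by simp
  qed
  \<comment> \<open>The coset of x0 alone contributes |L| e(x0)^2 to a total of |L|, so e(x0) is 1
    or -1 and nothing is left for the other cosets; the plain sum then fixes the sign.\<close>
  have "l * e x0 ^ 2 \<le> l * 1"
    using split[of "\<lambda>y. y ^ 2"] sum_sq sum_nonneg[of "carrier G - (L #> x0)" "\<lambda>x. e x ^ 2"] by simp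
  then have "e x0 ^ 2 \<le> 1" using l0 by (simp only: mult_le_cancel_left_pos)
  then have sq1: "e x0 ^ 2 = 1" using x0(2) by (smt (verit) zero_less_power2)
  then have "(\<Sum>x\<in>carrier G - (L #> x0). e x ^ 2) = 0" using split[of "\<lambda>y. y ^ 2"] sum_sq by simp
  then have zero: "e x = 0" if "x \<in> carrier G" "x \<notin> L #> x0" for x
    using that by (subst (asm) sum_nonneg_eq_0_iff) auto
  then have "l * e x0 = l * (- 1)" using split[of "\<lambda>y. y"] sum_e by simp
  then have "e x0 = - 1" using l0 by (simp only: mult_cancel_left) simp
  have "int (card (D \<inter> (L #> x))) = int c - (if x \<in> L #> x0 then int q else 0)" if x: "x \<in> carrier G" for x
  proof -
    have "int (card (D \<inter> (L #> x))) = int c + int q * e x" using P[OF x] x e[of x] by (simp add: E_def C_def)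
    then show ?thesis
      using zero[OF x] coset \<open>e x0 = - 1\<close> by auto
  qed
  with x0(1) show thesis by (intro that ballI)
qed

section \<open>Subgroups of finite abelian groups\<close>

text \<open>The quotient G/H has a subgroup S of order p; K is its preimage in G.\<close>

lemma exists_subgroup_card_mult_prime:
  fixes p :: nat
  assumes H: "subgroup H G" and p: "Factorial_Ring.prime p" and dvd: "card H * p dvd order G"
  obtains K where "subgroup K G" "card K = card H * p"
proof -
  interpret normal H G using H by (rule subgroup_imp_normal)
  interpret Q: group "G Mod H" by (rule factorgroup_is_group)
  have carrier_Q: "carrier (G Mod H) = rcosets H" by (simp add: FactGroup_def)
  have order_Q: "order (G Mod H) * card H = order G"
    using lagrange[OF H] by (simp add: order_def carrier_Q)
  have "card H > 0" using H by (simp add: subgroup.finite_imp_card_positive)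
  then have "p dvd order (G Mod H)" using dvd unfolding order_Q[symmetric] by (simp add: mult.commute)
  \<comment> \<open>Sylow's theorem with exponent 1 and an arbitrary cofactor r amounts to Cauchy's
    theorem.\<close>
  then obtain r where "order (G Mod H) = p ^ 1 * r" by (auto elim: dvdE)
  moreover have fin_Q: "finite (carrier (G Mod H))"
    unfolding carrier_FactGroup by (rule finite_imageI) (rule finite_carrier)
  ultimately obtain S where S: "subgroup S (G Mod H)" "card S = p"
    using sylow_thm[OF p Q.is_group, of 1 r] by auto
  define K where "K = {x \<in> carrier G. H #> x \<in> S}"
  have S_rcosets: "S \<subseteq> rcosets H" using subgroup.subset[OF S(1)] carrier_Q by simp
  have sub: "subgroup K G"
  proof
    show "K \<subseteq> carrier G" by (auto simp: K_def)
    show "x \<otimes> y \<in> K" if "x \<in> K" "y \<in> K" for x y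
      using that subgroup.m_closed[OF S(1), of "H #> x" "H #> y"] by (simp add: K_def rcos_sum)
    show "\<one> \<in> K" using subgroup.one_closed[OF S(1)] subset by (simp add: K_def coset_mult_one)
    show "inv x \<in> K" if "x \<in> K" for x
    proof -
      have x: "x \<in> carrier G" "H #> x \<in> S" using that by (auto simp: K_def)
      then have "H #> x \<in> carrier (G Mod H)" using S_rcosets carrier_Q by auto
      then have "inv\<^bsub>G Mod H\<^esub> (H #> x) = H #> inv x" using x by (simp add: inv_FactGroup rcos_inv)
      then show ?thesis using subgroup.m_inv_closed[OF S(1) x(2)] x by (simp add: K_def)
    qed
  qed
  \<comment> \<open>As the disjoint union of the p cosets in S, K has p |H| elements.\<close>
  have K_Union: "K = \<Union>S"
  proof
    show "K \<subseteq> \<Union>S" using rcos_self[OF _ H] by (auto simp: K_def)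
    show "\<Union>S \<subseteq> K"
    proof
      fix x assume "x \<in> \<Union>S"
      then obtain C where C: "C \<in> S" "x \<in> C" by auto
      then obtain a where a: "a \<in> carrier G" "C = H #> a" using S_rcosets by (auto simp: RCOSETS_def)
      then have "x \<in> carrier G" using C subset r_coset_subset_G by blast
      moreover have "H #> x = C" using a C repr_independence[OF _ a(1) H] by auto
      ultimately show "x \<in> K" using C by (simp add: K_def)
    qed
  qed
  have "card (\<Union>S) = sum card S"
  proof (rule card_Union_disjoint)
    show "pairwise disjnt S" using rcos_disjoint[OF H] S_rcosets pairwise_subset by blast
    show "finite C" if "C \<in> S" for C
      using that S_rcosets rcosets_part_G[OF H] finite_subset[OF _ finite_carrier] by blast
  qed
  also have "\<dots> = (\<Sum>C\<in>S. card H)"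
    using S_rcosets card_rcosets_equal subset by (intro sum.cong) auto
  finally have "card K = card H * p" by (simp add: K_Union S mult.commute)
  with sub show thesis by (rule that)
qed

text \<open>The converse of Lagrange for abelian groups, adjoining the prime factors of n one at a
  time.\<close>

lemma exists_subgroup_card:
  assumes "n dvd order G"
  obtains H where "subgroup H G" "card H = n"
proof -
  have "\<exists>H. subgroup H G \<and> card H = n"
    using assms
  proof (induction n rule: less_induct)
    case (less n)
    show ?case
    proof (cases "n = 1")
      case True
      then show ?thesis using triv_subgroup by (intro exI[of _ "{\<one>}"]) simp
    next
      case False
      then obtain p where p: "Factorial_Ring.prime p" "p dvd n" using prime_factor_nat by blast
      then obtain k where k: "n = k * p" by (metis dvdE mult.commute)
      have "n > 0" using less.prems order_gt_0_iff_finite by (metis dvd_pos_nat finite_carrier)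
      then have "k < n" using k prime_gt_1_nat[OF p(1)] by auto
      moreover have "k dvd order G" using less.prems k dvd_mult_left by blast
      ultimately obtain H where H: "subgroup H G" "card H = k" using less.IH by blast
      then show ?thesis
        using exists_subgroup_card_mult_prime[OF H(1) p(1)] less.prems k by metis
    qed
  qed
  then show thesis using that by blast
qed

text \<open>Second isomorphism theorem: r is the common index of N in N H and of the intersection in
  H.\<close>

lemma card_set_mult_mult_card_Int:
  assumes N: "subgroup N G" and H: "subgroup H G"
  obtains r where "card (N <#> H) = r * card N" "card H = r * card (N \<inter> H)"
proof -
  have NH: "subgroup (N <#> H) G" using mult_subgroups[OF N H] .
  have L: "subgroup (N \<inter> H) G" using subgroups_Inter_pair[OF N H] .
  let ?NH = "G\<lparr>carrier := N <#> H\<rparr>" and ?H = "G\<lparr>carrier := H\<rparr>"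
  have "N \<subseteq> N <#> H"
  proof
    fix x assume "x \<in> N"
    then have "x = x \<otimes> \<one>" using subgroup.subset[OF N] by auto
    then show "x \<in> N <#> H" using \<open>x \<in> N\<close> subgroup.one_closed[OF H] unfolding set_mult_def by blast
  qed
  then have N': "subgroup N ?NH" using N NH by (simp add: subgroup_incl)
  have L': "subgroup (N \<inter> H) ?H" using L H by (simp add: subgroup_incl)
  have "card (rcosets\<^bsub>?NH\<^esub> N) = card (rcosets\<^bsub>?H\<^esub> (N \<inter> H))"
    using iso_same_card[OF weak_snd_iso_thme[OF H subgroup_imp_normal[OF N]]] by (simp add: FactGroup_def)
  moreover have "card (rcosets\<^bsub>?NH\<^esub> N) * card N = card (N <#> H)"
    using group.lagrange[OF subgroup_imp_group[OF NH] N'] by (simp add: order_def)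
  moreover have "card (rcosets\<^bsub>?H\<^esub> (N \<inter> H)) * card (N \<inter> H) = card H"
    using group.lagrange[OF subgroup_imp_group[OF H] L'] by (simp add: order_def)
  ultimately show thesis using that by metis
qed

text \<open>Lagrange in the quotient by H. A subgroup of index q + 1 thereby meets the exponent
  hypothesis of \<open>difference_set_rcoset_intersections\<close>.\<close>

lemma pow_index_mem:
  assumes H: "subgroup H G" and x: "x \<in> carrier G"
  shows "x [^] card (rcosets H) \<in> H"
proof -
  interpret normal H G using H by (rule subgroup_imp_normal)
  interpret Q: group "G Mod H" by (rule factorgroup_is_group)
  have "H #> x \<in> carrier (G Mod H)" using x by (simp add: carrier_FactGroup)
  then have "(H #> x) [^]\<^bsub>G Mod H\<^esub> order (G Mod H) = H" using Q.pow_order_eq_1 by simp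
  moreover have "order (G Mod H) = card (rcosets H)" by (simp add: order_def FactGroup_def)
  ultimately have "H #> (x [^] card (rcosets H)) = H" using x by (simp add: FactGroup_pow)
  then show ?thesis using rcos_self[OF nat_pow_closed[OF x] H] by metis
qed

end

section \<open>The subgroup of order q^2 + 1 and its cosets\<close>

theorem theorem5p1:
  fixes G (structure) and q :: nat and D :: "'a set"
  assumes "prime_power q"
    and "comm_group G" and "finite (carrier G)"
    and "order G = (q + 1) * (q ^ 2 + 1)"
    and "difference_set G D ((q + 1) * (q ^ 2 + 1)) (q ^ 2 + q + 1) (q + 1)"
    and "normalized G D"
  shows "(\<exists>!K. subgroup K G \<and> card K = q ^ 2 + 1) \<and>
         (\<forall>K. subgroup K G \<and> card K = q ^ 2 + 1 \<longrightarrow>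
            (\<exists>!C. C \<in> rcosets K \<and> card (D \<inter> C) = 1) \<and>
            (\<forall>C \<in> rcosets K. card (D \<inter> C) \<noteq> 1 \<longrightarrow> card (D \<inter> C) = q + 1))"
proof -
  interpret comm_group G by fact
  interpret finite_comm_group G by unfold_locales fact
  note v = \<open>order G = (q + 1) * (q ^ 2 + 1)\<close>
  have D: "difference_set G D (order G) (q ^ 2 + q + 1) (q + 1)" using assms by simp
  obtain p m where p: "Factorial_Ring.prime p" and m: "m > 0" and q: "q = p ^ m"
    using \<open>prime_power q\<close> unfolding prime_power_def by blast
  have q2: "2 \<le> q"
    using prime_ge_2_nat[OF p] m self_le_power[of p m] unfolding q by linarith
  have cop1: "coprime q (q + 1)" by simp
  have cop2: "coprime q (q ^ 2 + 1)"
    by (rule coprimeI) (metis dvd_add_right_iff dvd_mult2 power2_eq_square)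
  have cop_q: "coprime q (order G)" unfolding v coprime_mult_right_iff using cop1 cop2 ..
  then have cop: "coprime p (order G)" using m by (simp add: q)
  \<comment> \<open>k is q^2 plus q + 1 and also q plus q^2 + 1, so coprimality with both factors of
    |G| reduces to that of q.\<close>
  have cop_k: "coprime (q ^ 2 + q + 1) (order G)"
  proof -
    have coprime_add: "coprime (a + b) b" if "coprime a b" for a b :: nat
      by (rule coprimeI) (metis that coprime_common_divisor dvd_add_left_iff)
    have "coprime (q ^ 2) (q + 1)" using cop1 by (simp only: coprime_power_left_iff simp_thms)
    then have "coprime (q ^ 2 + (q + 1)) (q + 1)" by (rule coprime_add)
    moreover have "coprime (q + (q ^ 2 + 1)) (q ^ 2 + 1)" using cop2 by (rule coprime_add)
    moreover have "q ^ 2 + (q + 1) = q ^ 2 + q + 1" "q + (q ^ 2 + 1) = q ^ 2 + q + 1" by simp_all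
    ultimately show ?thesis unfolding v coprime_mult_right_iff by (simp only:)
  qed
  have DG: "D \<subseteq> carrier G" using D by (auto simp: difference_set_def)
  have Dp: "d [^] p \<in> D" if "d \<in> D" for d
  proof (rule normalized_difference_set_pow_closed[OF p cop cop_k D \<open>normalized G D\<close> _ _ that])
    \<comment> \<open>Here k - lam = q^2 = p^(2 m); the bound lam < q^2 uses q at least 2.\<close>
    show "q ^ 2 + q + 1 = (q + 1) + p ^ (2 * m)" by (simp add: q mult.commute power_mult)
    have "2 * q \<le> q * q" using q2 by (rule mult_le_mono1)
    then have "q + 1 < q * q" using q2 by linarith
    then show "q + 1 < p ^ (2 * m)" by (simp add: q mult.commute power_mult power2_eq_square)
  qed
  have "d [^] (p ^ i) \<in> D" if "d \<in> D" for d i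
  proof (induction i)
    case 0 then show ?case using that DG by auto
  next
    case (Suc i)
    have "d [^] (p ^ Suc i) = (d [^] (p ^ i)) [^] p" using that DG by (simp add: nat_pow_pow mult.commute subset_eq)
    then show ?case using Dp[OF Suc] by simp
  qed
  then have Dq: "d [^] q \<in> D" if "d \<in> D" for d using that unfolding q by blast
  obtain e where "e > 0" and period: "\<And>x. x \<in> carrier G \<Longrightarrow> x [^] (q ^ e) = x"
    using exists_pow_period[OF _ cop_q] q2 by auto
  \<comment> \<open>A power of q inverts the q-th power map, which is therefore injective.\<close>
  then have "(x [^] q) [^] (q ^ (e - 1)) = x" if "x \<in> carrier G" for x
    using that by (simp add: nat_pow_pow flip: power_Suc)
  then have inj: "inj_on (\<lambda>d. d [^] q) D" using DG by (intro inj_onI) (metis subsetD)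
  note intersections = difference_set_rcoset_intersections[OF p q cop v D Dq inj]
  have index: "card (rcosets K) = q + 1" if "subgroup K G" "card K = q ^ 2 + 1" for K
  proof -
    have "card (rcosets K) * (q ^ 2 + 1) = (q + 1) * (q ^ 2 + 1)"
      using lagrange[OF that(1)] unfolding v that(2) .
    then show ?thesis by (subst (asm) mult_right_cancel) simp_all
  qed

  have unique: "K1 = K2" if K1: "subgroup K1 G" "card K1 = q ^ 2 + 1" and K2: "subgroup K2 G" "card K2 = q ^ 2 + 1" for K1 K2
  proof -
    define L where "L = K1 \<inter> K2"
    have L: "subgroup L G" unfolding L_def by (rule subgroups_Inter_pair[OF K1(1) K2(1)])
    obtain r where r: "card (K1 <#> K2) = r * card K1" "card K2 = r * card L"
      using card_set_mult_mult_card_Int[OF K1(1) K2(1)] unfolding L_def by blast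
    \<comment> \<open>The common index r divides [G : K1] = q + 1, which supplies the integer c = (q
      + 1) / r.\<close>
    have "card (K1 <#> K2) dvd order G"
      using lagrange[OF mult_subgroups[OF K1(1) K2(1)]] by (metis dvd_triv_right)
    then have "r * (q ^ 2 + 1) dvd (q + 1) * (q ^ 2 + 1)" unfolding r(1) K1(2) v .
    then have "r dvd q + 1" by (subst (asm) dvd_times_right_cancel_iff) simp_all
    then obtain c where c: "q + 1 = r * c" by (rule dvdE)
    \<comment> \<open>[G : L] = [G : K2] [K2 : L] = (q + 1) r, so c times this index is (q +
      1)^2.\<close>
    have "card (rcosets L) * card L = (q + 1) * (r * card L)"
      using lagrange[OF L] unfolding v K2(2)[symmetric] r(2) .
    moreover have "card L > 0" using L by (simp add: subgroup.finite_imp_card_positive)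
    ultimately have "card (rcosets L) = (q + 1) * r" by (simp only: mult.assoc[symmetric] mult_right_cancel)
    then have "c * card (rcosets L) = (q + 1) * (r * c)" by (simp only: mult_ac)
    then have L_index: "c * card (rcosets L) = (q + 1) ^ 2" by (simp only: c[symmetric] power2_eq_square)
    have L_exponent: "x [^] (q + 1) \<in> L" if "x \<in> carrier G" for x
      using pow_index_mem[OF K1(1) that] pow_index_mem[OF K2(1) that] index K1 K2 by (simp add: L_def)
    obtain x0 where "x0 \<in> carrier G"
      "\<forall>x\<in>carrier G. int (card (D \<inter> (L #> x))) = int c - (if x \<in> L #> x0 then int q else 0)"
      by (rule intersections[OF _ L L_exponent L_index])
    \<comment> \<open>The exceptional coset of L meets D in c - q elements, a nonnegative
      number.\<close>
    then have "int c - int q \<ge> 0" using rcos_self[OF _ L] by (metis of_nat_0_le_iff)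
    then have "q \<le> c" by simp
    have "r = 1"
    proof (rule ccontr)
      assume "r \<noteq> 1"
      \<comment> \<open>With r at least 2 and c at least q, q + 1 = r c would be at least 2
        q.\<close>
      then have "2 \<le> r" using c by (cases r) auto
      then have "2 * q \<le> r * c" using \<open>q \<le> c\<close> by (rule mult_le_mono)
      then show False using c q2 by linarith
    qed
    then have "card L = card K1" "card L = card K2" using r K1 K2 by simp_all
    moreover have "finite K1" "finite K2" using K1 K2 subgroup.subset finite_subset finite_carrier by metis+
    ultimately have "L = K1" "L = K2" unfolding L_def by (metis card_subset_eq inf_le1, metis card_subset_eq inf_le2)
    then show ?thesis by simp
  qed

  have part2: "(\<exists>!C. C \<in> rcosets K \<and> card (D \<inter> C) = 1) \<and>
      (\<forall>C \<in> rcosets K. card (D \<inter> C) \<noteq> 1 \<longrightarrow> card (D \<inter> C) = q + 1)"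
    if K: "subgroup K G" "card K = q ^ 2 + 1" for K
  proof -
    \<comment> \<open>For K itself the constant c is q + 1, so the exceptional count is 1.\<close>
    have K_index: "(q + 1) * card (rcosets K) = (q + 1) ^ 2" using index[OF K] by (simp add: power2_eq_square)
    have K_exponent: "x [^] (q + 1) \<in> K" if "x \<in> carrier G" for x
      using pow_index_mem[OF K(1) that] index[OF K] by simp
    obtain x0 where x0: "x0 \<in> carrier G"
      "\<forall>x\<in>carrier G. int (card (D \<inter> (K #> x))) = int (q + 1) - (if x \<in> K #> x0 then int q else 0)"
      by (rule intersections[OF _ K(1) K_exponent K_index])
    have card: "card (D \<inter> C) = (if C = K #> x0 then 1 else q + 1)" if "C \<in> rcosets K" for C
    proof -
      obtain x where x: "x \<in> carrier G" "C = K #> x" using \<open>C \<in> rcosets K\<close> by (auto simp: RCOSETS_def)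
      have "x \<in> K #> x0 \<longleftrightarrow> C = K #> x0"
        using x rcos_self[OF x(1) K(1)] repr_independence[OF _ x0(1) K(1)] by metis
      then show ?thesis using x0(2) x by (auto split: if_splits)
    qed
    have x0_rcoset: "K #> x0 \<in> rcosets K" using x0 rcosetsI[OF subgroup.subset[OF K(1)]] by simp
    show ?thesis
    proof (intro conjI ballI impI)
      show "\<exists>!C. C \<in> rcosets K \<and> card (D \<inter> C) = 1"
      proof (rule ex1I)
        show "K #> x0 \<in> rcosets K \<and> card (D \<inter> (K #> x0)) = 1" using x0_rcoset card by simp
        show "C = K #> x0" if "C \<in> rcosets K \<and> card (D \<inter> C) = 1" for C
          using that card[of C] q2 by (cases "C = K #> x0") simp_all
      qed
      show "card (D \<inter> C) = q + 1" if "C \<in> rcosets K" "card (D \<inter> C) \<noteq> 1" for C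
        using that card[of C] by (cases "C = K #> x0") simp_all
    qed
  qed

  have "q ^ 2 + 1 dvd order G" unfolding v by (rule dvd_triv_right)
  then obtain K where K: "subgroup K G" "card K = q ^ 2 + 1" by (rule exists_subgroup_card)
  have "\<exists>!K. subgroup K G \<and> card K = q ^ 2 + 1"
  proof (rule ex1I)
    show "subgroup K G \<and> card K = q ^ 2 + 1" using K ..
    show "K' = K" if "subgroup K' G \<and> card K' = q ^ 2 + 1" for K'
      by (rule unique) (use that K in auto)
  qed
  moreover have "\<forall>K. subgroup K G \<and> card K = q ^ 2 + 1 \<longrightarrow>
      (\<exists>!C. C \<in> rcosets K \<and> card (D \<inter> C) = 1) \<and>
      (\<forall>C \<in> rcosets K. card (D \<inter> C) \<noteq> 1 \<longrightarrow> card (D \<inter> C) = q + 1)"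
  proof (intro allI impI)
    fix K assume "subgroup K G \<and> card K = q ^ 2 + 1"
    then show "(\<exists>!C. C \<in> rcosets K \<and> card (D \<inter> C) = 1) \<and>
      (\<forall>C \<in> rcosets K. card (D \<inter> C) \<noteq> 1 \<longrightarrow> card (D \<inter> C) = q + 1)"
      using part2[of K] by (elim conjE)
  qed
  ultimately show ?thesis ..
qed

end
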